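(* Let $D$ be a positive integer and let $\Gamma\subseteq\mathbb{R}^D$ be orthosymmetric, compact and convex. Then for every $\epsilon>0$, $$n_{\mathrm{gof}}\Big(\Gamma,\frac{\epsilon}{\sqrt2}\Big)^2\ge \frac{1}{64\log(2D)}\cdot\frac{n_{\mathrm{est}}(\Gamma,\epsilon)}{\epsilon^2}.$$
   Context: A set $\Gamma\subseteq\mathbb{R}^D$ is orthosymmetric if for every $\boldsymbol\theta=(\theta_1,\dots,\theta_D)\in\Gamma$ and every sign vector $(\epsilon_1,\dots,\epsilon_D)\in\{-1,1\}^D$, $(\epsilon_1\theta_1,\dots,\epsilon_D\theta_D)\in\Gamma$. Model: $\{\mathcal N(\boldsymbol\theta,I_D):\boldsymbol\theta\in\Gamma\}$. $n_{\mathrm{est}}(\Gamma,\epsilon)$ is the smallest $n$ such that from $n$ i.i.d. samples of $\mathcal N(\boldsymbol\theta,I_D)$ some estimator $\hat{\boldsymbol\theta}$ achieves $\sup_{\boldsymbol\theta\in\Gamma}\mathbb E\|\hat{\boldsymbol\theta}-\boldsymbol\theta\|_2^2\le\epsilon^2$. $n_{\mathrm{gof}}(\Gamma,\epsilon)$ is the smallest $n$ such that from $n$ i.i.d. samples of $\mathcal N(\boldsymbol\theta,I_D)$, $\boldsymbol\theta\in\Gamma$, some test $\psi\in\{0,1\}$ of $H_0:\boldsymbol\theta=\mathbf 0$ vs $H_1:\boldsymbol\theta\in\Gamma,\|\boldsymbol\theta\|_2\ge\epsilon$ has $\mathbb P_{\mathbf 0}(\psi=1)\le1/4$ and $\sup_{H_1}\mathbb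 P_{\boldsymbol\theta}(\psi=0)\le 1/4$. *)

theory Defs
  imports "HOL-Probability.Probability"
begin

definition orthosymmetric :: "(real ^ 'd) set \<Rightarrow> bool" where
  "orthosymmetric \<Gamma> \<longleftrightarrow>
     (\<forall>\<theta>\<in>\<Gamma>. \<forall>s :: 'd \<Rightarrow> real. (\<forall>i. s i \<in> {-1, 1}) \<longrightarrow> (\<chi> i. s i * \<theta> $ i) \<in> \<Gamma>)"

definition gauss :: "real ^ 'd \<Rightarrow> (real ^ 'd) measure" where
  "gauss \<theta> = density lborel (\<lambda>x. ennreal (\<Prod>i\<in>UNIV. normal_density (\<theta> $ i) 1 (x $ i)))"

definition samples :: "nat \<Rightarrow> real ^ 'd \<Rightarrow> (nat \<Rightarrow> real ^ 'd) measure" where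
  "samples n \<theta> = PiM {..<n} (\<lambda>_. gauss \<theta>)"

definition sample_space :: "nat \<Rightarrow> (nat \<Rightarrow> real ^ 'd) measure" where
  "sample_space n = PiM {..<n} (\<lambda>_. borel)"

definition est_ok :: "(real ^ 'd) set \<Rightarrow> real \<Rightarrow> nat \<Rightarrow> bool" where
  "est_ok \<Gamma> \<epsilon> n \<longleftrightarrow>
     (\<exists>f :: (nat \<Rightarrow> real ^ 'd) \<Rightarrow> real ^ 'd. f \<in> borel_measurable (sample_space n) \<and>
        (\<forall>\<theta>\<in>\<Gamma>. (\<integral>\<^sup>+ x. ennreal ((norm (f x - \<theta>))\<^sup>2) \<partial>samples n \<theta>) \<le> ennreal (\<epsilon>\<^sup>2)))"

definition n_est :: "(real ^ 'd) set \<Rightarrow> real \<Rightarrow> nat" where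
  "n_est \<Gamma> \<epsilon> = (LEAST n. est_ok \<Gamma> \<epsilon> n)"

definition gof_ok :: "(real ^ 'd) set \<Rightarrow> real \<Rightarrow> nat \<Rightarrow> bool" where
  "gof_ok \<Gamma> \<epsilon> n \<longleftrightarrow>
     (\<exists>\<psi> :: (nat \<Rightarrow> real ^ 'd) \<Rightarrow> bool. \<psi> \<in> measurable (sample_space n) (count_space UNIV) \<and>
        measure (samples n 0) {x \<in> space (samples n 0). \<psi> x} \<le> 1/4 \<and>
        (\<forall>\<theta>\<in>\<Gamma>. norm \<theta> \<ge> \<epsilon> \<longrightarrow>
            measure (samples n \<theta>) {x \<in> space (samples n \<theta>). \<not> \<psi> x} \<le> 1/4))"

definition n_gof :: "(real ^ 'd) set \<Rightarrow> real \<Rightarrow> nat" where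
  "n_gof \<Gamma> \<epsilon> = (LEAST n. gof_ok \<Gamma> \<epsilon> n)"

end

theory Submission
  imports Defs
begin

text \<open>
  Let \<open>\<delta> = \<epsilon> / \<surd>2\<close> and suppose that \<open>n\<close> samples suffice for testing at radius \<open>\<delta>\<close>. Mixing the
  alternative over all sign changes of a point \<open>\<theta>\<close> with \<open>\<parallel>\<theta>\<parallel> \<ge> \<delta>\<close> shows
  \<open>n\<^sup>2 \<parallel>\<theta>\<parallel>\<^sub>4\<^sup>4 \<ge> 1\<close>. An orthosymmetric convex set contains every vector that is dominated
  coordinatewise by one of its points, so truncating \<open>\<theta>\<close> at a level \<open>T\<close> with
  \<open>n T \<delta> < 1\<close> must bring its norm below \<open>\<delta>\<close>; that is,
  \<open>\<Sum>i. min \<theta>\<^sub>i\<^sup>2 T\<^sup>2 < \<epsilon>\<^sup>2 / 2\<close> on all of \<open>\<Gamma>\<close>. Soft thresholding the sample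
  mean of \<open>m \<approx> 64 log (2D) n\<^sup>2 \<epsilon>\<^sup>2\<close> observations at level \<open>T / 2\<close> with
  \<open>T\<^sup>2 = 64 log (2D) / m\<close> has risk at most this sum plus \<open>8 / m \<le> \<epsilon>\<^sup>2 / 2\<close>.
\<close>

section \<open>A sub-Gaussian bound for a random sign\<close>

text \<open>Hoeffding's lemma for a fair sign, that is, cosh x is at most exp of half the square of
  x. It controls each coordinate of the sign mixture.\<close>

lemma exp_plus_exp_minus_le:
  fixes x :: real
  shows "exp x + exp (- x) \<le> 2 * exp (x\<^sup>2 / 2)"
proof -
  have *: "exp x + exp (- x) \<le> 2 * exp (x\<^sup>2 / 2)" if "x \<ge> 0" for x :: real
  proof -
    \<comment> \<open>With success probability 1/2 and range \<open>2 * x\<close>, the left-hand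
      side is exactly ln (cosh x).\<close>
    have "- (2 * x) * (1/2) + ln (1 + (1/2) * (exp (2 * x) - 1)) \<le> (2 * x)\<^sup>2 / 8"
      using Hoeffdings_lemma_aux[of "2 * x" "1/2"] that by simp
    then have "ln ((1 + exp (2 * x)) / 2) \<le> x\<^sup>2 / 2 + x"
      by (simp add: field_simps power2_eq_square)
    then have "exp (ln ((1 + exp (2 * x)) / 2)) \<le> exp (x\<^sup>2 / 2 + x)"
      by (simp only: exp_le_cancel_iff)
    moreover have "exp (ln ((1 + exp (2 * x)) / 2)) = (1 + exp (2 * x)) / 2"
      by (intro exp_ln) (auto intro: add_pos_pos)
    ultimately have "(1 + exp (2 * x)) / 2 \<le> exp (x\<^sup>2 / 2) * exp x"
      by (simp only: exp_add)
    then have "(1 + exp (2 * x)) * exp (- x) \<le> (2 * (exp (x\<^sup>2 / 2) * exp x)) * exp (- x)"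
      by (intro mult_right_mono) auto
    then show ?thesis
      by (simp add: algebra_simps flip: exp_add)
  qed
  show ?thesis
    using *[of x] *[of "- x"] by (cases "x \<ge> 0") (auto simp: add.commute)
qed

section \<open>Gaussian measures and densities on finite products\<close>

lemma prob_space_gauss: "prob_space (gauss \<theta>)"
proof
  have inj: "inj (\<lambda>i::'a. axis i (1::real))"
    by (auto simp: inj_def axis_eq_axis)
  \<comment> \<open>The product formula for \<open>lborel\<close> runs over \<open>Basis\<close>;
    reindexing by \<open>axis\<close> turns it into a product over coordinates.\<close>
  have B: "(Basis :: (real ^ 'a) set) = range (\<lambda>i. axis i 1)"
    by (auto simp: Basis_vec_def)
  have eq: "(\<Prod>b\<in>Basis. ennreal (normal_density (\<theta> \<bullet> b) 1 (x \<bullet> b)))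
      = ennreal (\<Prod>i\<in>UNIV. normal_density (\<theta> $ i) 1 (x $ i))" for x :: "real ^ 'a"
    unfolding B by (subst prod.reindex[OF inj]) (simp add: inner_axis prod_ennreal)
  have nd: "(\<integral>\<^sup>+x. ennreal (normal_density \<mu> 1 x) \<partial>lborel) = 1" for \<mu>
    by (subst nn_integral_eq_integral) auto
  have "emeasure (gauss \<theta>) (space (gauss \<theta>))
      = (\<integral>\<^sup>+x. (\<Prod>b\<in>Basis. ennreal (normal_density (\<theta> \<bullet> b) 1 (x \<bullet> b))) \<partial>lborel)"
    unfolding gauss_def by (simp add: emeasure_density eq)
  also have "\<dots> = (\<Prod>b\<in>(Basis :: (real ^ 'a) set).
      \<integral>\<^sup>+x. ennreal (normal_density (\<theta> \<bullet> b) 1 x) \<partial>lborel)"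
    by (rule nn_integral_lborel_prod) auto
  also have "\<dots> = 1"
    by (simp add: nd)
  finally show "emeasure (gauss \<theta>) (space (gauss \<theta>)) = 1" .
qed

lemma sets_gauss [measurable_cong, simp]: "sets (gauss \<theta>) = sets borel"
  by (simp add: gauss_def)

lemma space_gauss [simp]: "space (gauss \<theta>) = UNIV"
  by (simp add: gauss_def)

lemma norm_power2_vec: "(norm (x :: real ^ 'd))\<^sup>2 = (\<Sum>i\<in>UNIV. (x $ i)\<^sup>2)"
  by (simp add: norm_vec_def L2_set_def sum_nonneg)

text \<open>Completing the square in each coordinate gives the likelihood ratio against the null.
  All integrals can then be moved to the centred Gaussian.\<close>

lemma gauss_eq_density:
  "gauss \<theta> = density (gauss 0) (\<lambda>x. ennreal (exp (\<theta> \<bullet> x - (norm \<theta>)\<^sup>2 / 2)))"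
proof -
  have nd: "normal_density \<mu> 1 y = normal_density 0 1 y * exp (\<mu> * y - \<mu>\<^sup>2 / 2)" for \<mu> y :: real
  proof -
    have "- ((y - \<mu>)\<^sup>2) / 2 = - (y\<^sup>2) / 2 + (\<mu> * y - \<mu>\<^sup>2 / 2)"
      by (simp add: power2_eq_square field_simps)
    then show ?thesis
      by (simp only: normal_density_def flip: exp_add) (simp flip: exp_add)
  qed
  have "(\<Prod>i\<in>UNIV. normal_density (\<theta> $ i) 1 (x $ i))
      = (\<Prod>i\<in>UNIV. normal_density 0 1 (x $ i)) * exp (\<theta> \<bullet> x - (norm \<theta>)\<^sup>2 / 2)" for x
    by (subst nd) (simp add: prod.distrib exp_sum[symmetric] sum_subtractf inner_vec_def norm_power2_vec
          sum_divide_distrib)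
  then show ?thesis
    unfolding gauss_def
    by (subst density_density_eq) (auto simp: ennreal_mult prod_nonneg)
qed

text \<open>A product measure is determined by its values on rectangles, and there the integral of
  the product density factors.\<close>

lemma PiM_density:
  assumes "finite I" and M: "\<And>i. i \<in> I \<Longrightarrow> f i \<in> borel_measurable (M i)"
    and "product_sigma_finite M" and "product_sigma_finite (\<lambda>i. density (M i) (f i))"
  shows "PiM I (\<lambda>i. density (M i) (f i)) = density (PiM I M) (\<lambda>x. \<Prod>i\<in>I. f i (x i))"
proof -
  interpret M: product_sigma_finite M by fact
  interpret N: product_sigma_finite "\<lambda>i. density (M i) (f i)" by fact
  note M[measurable]
  have s: "sets (PiM I (\<lambda>i. density (M i) (f i))) = sets (PiM I M)"
    by (intro sets_PiM_cong) auto
  show ?thesis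
  proof (rule sym, rule N.PiM_eqI)
    fix A assume A: "\<And>i. i \<in> I \<Longrightarrow> A i \<in> sets (density (M i) (f i))"
    then have A'[measurable]: "\<And>i. i \<in> I \<Longrightarrow> A i \<in> sets (M i)" by simp
    have "emeasure (density (PiM I M) (\<lambda>x. \<Prod>i\<in>I. f i (x i))) (Pi\<^sub>E I A)
       = (\<integral>\<^sup>+x. (\<Prod>i\<in>I. f i (x i)) * indicator (Pi\<^sub>E I A) x \<partial>PiM I M)"
      using assms(1) A' by (intro emeasure_density sets_PiM_I_finite) auto
    also have "\<dots> = (\<integral>\<^sup>+x. (\<Prod>i\<in>I. f i (x i) * indicator (A i) (x i)) \<partial>PiM I M)"
    proof (intro nn_integral_cong)
      fix x assume "x \<in> space (PiM I M)"
      then have "indicator (Pi\<^sub>E I A) x = (\<Prod>i\<in>I. indicator (A i) (x i) :: ennreal)"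
        using assms(1)
        by (auto simp: indicator_def PiE_iff space_PiM prod_eq_1_iff intro!: prod_zero[symmetric])
      then show "(\<Prod>i\<in>I. f i (x i)) * indicator (Pi\<^sub>E I A) x
          = (\<Prod>i\<in>I. f i (x i) * indicator (A i) (x i))"
        by (simp add: prod.distrib)
    qed
    also have "\<dots> = (\<Prod>i\<in>I. \<integral>\<^sup>+x. f i x * indicator (A i) x \<partial>M i)"
      using assms(1) A' by (intro M.product_nn_integral_prod) auto
    also have "\<dots> = (\<Prod>i\<in>I. emeasure (density (M i) (f i)) (A i))"
      using A' by (intro prod.cong refl) (auto simp: emeasure_density)
    finally show "emeasure (density (PiM I M) (\<lambda>x. \<Prod>i\<in>I. f i (x i))) (Pi\<^sub>E I A)
        = (\<Prod>i\<in>I. emeasure (density (M i) (f i)) (A i))" .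
  qed (use assms(1) s in auto)
qed

section \<open>The i.i.d. sample, its likelihood ratio and exponential moments\<close>

lemma prob_space_samples: "prob_space (samples n \<theta>)"
  unfolding samples_def by (intro prob_space_PiM prob_space_gauss)

lemma sets_samples [measurable_cong, simp]: "sets (samples n \<theta>) = sets (sample_space n)"
  unfolding samples_def sample_space_def by (intro sets_PiM_cong) auto

lemma space_samples: "space (samples n \<theta>) = space (sample_space n)"
  by (rule sets_eq_imp_space_eq) simp

lemma measurable_sum_samples [measurable]:
  "(\<lambda>x. \<Sum>j<n. x j) \<in> borel_measurable (sample_space n :: (nat \<Rightarrow> real ^ 'd) measure)"
  unfolding sample_space_def by (intro borel_measurable_sum measurable_component_singleton) auto

lemma measurable_sum_samples_component [measurable]:
  "(\<lambda>x. (\<Sum>j<n. x j) $ i) \<in> borel_measurable (sample_space n :: (nat \<Rightarrow> real ^ 'd) measure)"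
  by (rule measurable_compose[OF measurable_sum_samples]) simp

text \<open>Multiplying the single-sample ratios adds the exponents, so the likelihood ratio depends
  on the data only through the sum, the sufficient statistic.\<close>

lemma samples_eq_density:
  fixes \<theta> :: "real ^ 'd"
  shows "samples n \<theta> = density (samples n 0)
     (\<lambda>x. ennreal (exp (\<theta> \<bullet> (\<Sum>j<n. x j) - real n * (norm \<theta>)\<^sup>2 / 2)))"
proof -
  interpret g: prob_space "gauss t" for t :: "real ^ 'd" by (rule prob_space_gauss)
  have d: "(\<lambda>_::nat. density (gauss 0) (\<lambda>x. ennreal (exp (\<theta> \<bullet> x - (norm \<theta>)\<^sup>2 / 2)))) = (\<lambda>_. gauss \<theta>)"
    by (simp only: gauss_eq_density[of \<theta>, symmetric])
  have psf: "product_sigma_finite (\<lambda>_::nat. gauss t)" for t :: "real ^ 'd"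
    by (intro product_sigma_finite.intro g.sigma_finite_measure_axioms)
  have "samples n \<theta> = density (samples n 0)
     (\<lambda>x. \<Prod>j<n. ennreal (exp (\<theta> \<bullet> x j - (norm \<theta>)\<^sup>2 / 2)))"
    using PiM_density[of "{..<n}" "\<lambda>_ x. ennreal (exp (\<theta> \<bullet> x - (norm \<theta>)\<^sup>2 / 2))" "\<lambda>_. gauss 0"] psf
    unfolding samples_def d by simp
  also have "(\<lambda>x. \<Prod>j<n. ennreal (exp (\<theta> \<bullet> x j - (norm \<theta>)\<^sup>2 / 2)))
     = (\<lambda>x. ennreal (exp (\<theta> \<bullet> (\<Sum>j<n. x j) - real n * (norm \<theta>)\<^sup>2 / 2)))"
    by (simp add: prod_ennreal exp_sum[symmetric] sum_subtractf inner_sum_right)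
  finally show ?thesis .
qed

text \<open>Since every \<^term>\<open>samples n u\<close> has total mass one, its density with respect to
  \<^term>\<open>samples n 0\<close> yields all exponential moments.\<close>

lemma nn_integral_samples_0_exp:
  "(\<integral>\<^sup>+x. ennreal (exp (u \<bullet> (\<Sum>j<n. x j) + c)) \<partial>samples n 0)
     = ennreal (exp (real n * (norm u)\<^sup>2 / 2 + c))"
proof -
  let ?k = "real n * (norm u)\<^sup>2 / 2"
  have "(\<integral>\<^sup>+x. ennreal (exp (u \<bullet> (\<Sum>j<n. x j) + c)) \<partial>samples n 0)
      = (\<integral>\<^sup>+x. ennreal (exp (?k + c)) * ennreal (exp (u \<bullet> (\<Sum>j<n. x j) - ?k)) \<partial>samples n 0)"
    by (intro nn_integral_cong) (simp add: algebra_simps flip: ennreal_mult exp_add)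
  also have "\<dots> = ennreal (exp (?k + c)) * emeasure (samples n u) (space (samples n u))"
  proof -
    have "emeasure (samples n u) (space (samples n u))
        = emeasure (density (samples n 0) (\<lambda>x. ennreal (exp (u \<bullet> (\<Sum>j<n. x j) - ?k))))
            (space (samples n 0))"
      by (simp only: samples_eq_density[of n u, symmetric] space_samples)
    also have "\<dots> = (\<integral>\<^sup>+x. ennreal (exp (u \<bullet> (\<Sum>j<n. x j) - ?k)) \<partial>samples n 0)"
      by (subst emeasure_density) (auto intro!: nn_integral_cong simp: space_samples)
    finally show ?thesis
      by (simp add: nn_integral_cmult)
  qed
  finally show ?thesis
    by (simp add: prob_space.emeasure_space_1[OF prob_space_samples])
qed

text \<open>Changing measure to the null tilts by \<open>\<theta> + u\<close> in place of
  \<open>u\<close>; the terms in \<open>\<theta>\<close> then cancel. This moment generating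
  function drives the tail bounds for the sample mean.\<close>

lemma nn_integral_samples_exp:
  "(\<integral>\<^sup>+x. ennreal (exp (u \<bullet> ((\<Sum>j<n. x j) - real n *\<^sub>R \<theta>))) \<partial>samples n \<theta>)
     = ennreal (exp (real n * (norm u)\<^sup>2 / 2))"
proof -
  let ?k = "real n * (norm \<theta>)\<^sup>2 / 2"
  have "(\<integral>\<^sup>+x. ennreal (exp (u \<bullet> ((\<Sum>j<n. x j) - real n *\<^sub>R \<theta>))) \<partial>samples n \<theta>)
    = (\<integral>\<^sup>+x. ennreal (exp ((\<theta> + u) \<bullet> (\<Sum>j<n. x j) + (- ?k - real n * (u \<bullet> \<theta>)))) \<partial>samples n 0)"
    by (subst samples_eq_density, subst nn_integral_density)
       (auto intro!: nn_integral_cong simp: algebra_simps inner_diff_right simp flip: ennreal_mult exp_add)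
  also have "\<dots> = ennreal (exp (real n * (norm u)\<^sup>2 / 2))"
    unfolding nn_integral_samples_0_exp
    by (simp add: power2_norm_eq_inner algebra_simps add_divide_distrib inner_commute)
  finally show ?thesis .
qed

text \<open>The two tilts merge into a tilt by \<open>a + b\<close>, and only the cross term of its
  squared norm survives the normalisation. Summed over pairs of sign vectors, this gives the second
  moment of the mixture.\<close>

lemma nn_integral_likelihood_ratio_mult:
  fixes a b :: "real ^ 'd"
  shows "(\<integral>\<^sup>+x. ennreal (exp (a \<bullet> (\<Sum>j<n. x j) - real n * (norm a)\<^sup>2 / 2)
              * exp (b \<bullet> (\<Sum>j<n. x j) - real n * (norm b)\<^sup>2 / 2)) \<partial>samples n 0)
     = ennreal (exp (real n * (a \<bullet> b)))"
proof -
  let ?c = "- (real n * (norm a)\<^sup>2 / 2) - real n * (norm b)\<^sup>2 / 2"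
  have "(\<integral>\<^sup>+x. ennreal (exp (a \<bullet> (\<Sum>j<n. x j) - real n * (norm a)\<^sup>2 / 2)
              * exp (b \<bullet> (\<Sum>j<n. x j) - real n * (norm b)\<^sup>2 / 2)) \<partial>samples n 0)
     = (\<integral>\<^sup>+x. ennreal (exp ((a + b) \<bullet> (\<Sum>j<n. x j) + ?c)) \<partial>samples n 0)"
    by (intro nn_integral_cong) (simp add: inner_add_left algebra_simps flip: exp_add)
  also have "\<dots> = ennreal (exp (real n * (norm (a + b))\<^sup>2 / 2 + ?c))"
    by (rule nn_integral_samples_0_exp)
  also have "real n * (norm (a + b))\<^sup>2 / 2 + ?c = real n * (a \<bullet> b)"
    by (simp add: power2_norm_eq_inner algebra_simps add_divide_distrib inner_commute
          del: dot_square_norm)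
  finally show ?thesis .
qed

section \<open>The lower bound for testing by a sign mixture\<close>

text \<open>For fixed \<open>s\<close> the sum over \<open>t\<close> factors over coordinates. As
  each \<open>s i\<close> squares to 1, every factor is twice a hyperbolic cosine, bounded by
  \<open>exp_plus_exp_minus_le\<close>.\<close>

lemma sum_signs_exp_le:
  fixes \<theta> :: "real ^ 'd"
  defines "S \<equiv> (UNIV :: 'd set) \<rightarrow>\<^sub>E {-1, 1::real}"
  assumes s: "s \<in> S"
  shows "(\<Sum>t\<in>S. exp (real n * ((\<chi> i. s i * \<theta> $ i) \<bullet> (\<chi> i. t i * \<theta> $ i))))
     \<le> 2 ^ CARD('d) * exp ((real n)\<^sup>2 * (\<Sum>i\<in>UNIV. (\<theta> $ i) ^ 4) / 2)"
proof -
  have "(\<Sum>t\<in>S. exp (real n * ((\<chi> i. s i * \<theta> $ i) \<bullet> (\<chi> i. t i * \<theta> $ i))))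
     = (\<Sum>t\<in>S. \<Prod>i\<in>UNIV. exp (real n * (s i * (\<theta> $ i)\<^sup>2) * t i))"
    by (intro sum.cong refl)
       (simp add: inner_vec_def sum_distrib_left power2_eq_square mult_ac flip: exp_sum)
  also have "\<dots> = (\<Prod>i\<in>(UNIV :: 'd set). \<Sum>y\<in>{-1, 1}. exp (real n * (s i * (\<theta> $ i)\<^sup>2) * y))"
    unfolding S_def by (subst prod_sum_PiE) auto
  also have "\<dots> \<le> (\<Prod>i\<in>(UNIV :: 'd set). 2 * exp ((real n)\<^sup>2 * (\<theta> $ i) ^ 4 / 2))"
  proof (intro prod_mono conjI)
    fix i :: 'd
    have "s i \<in> {-1, 1}" using s unfolding S_def by auto
    then have "(s i)\<^sup>2 = 1" by auto
    then have "(real n * (s i * (\<theta> $ i)\<^sup>2))\<^sup>2 = (real n)\<^sup>2 * (\<theta> $ i) ^ 4"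
      by (simp add: power_mult_distrib)
    then show "(\<Sum>y\<in>{-1, 1}. exp (real n * (s i * (\<theta> $ i)\<^sup>2) * y))
        \<le> 2 * exp ((real n)\<^sup>2 * (\<theta> $ i) ^ 4 / 2)"
      using exp_plus_exp_minus_le[of "real n * (s i * (\<theta> $ i)\<^sup>2)"] by (simp add: add.commute)
  qed (auto intro!: sum_nonneg)
  also have "\<dots> = 2 ^ CARD('d) * exp ((real n)\<^sup>2 * (\<Sum>i\<in>UNIV. (\<theta> $ i) ^ 4) / 2)"
    by (simp add: prod.distrib exp_sum[symmetric] sum_distrib_left sum_divide_distrib)
  finally show ?thesis .
qed

text \<open>The alternative is replaced by the uniform mixture over all sign changes of \<^term>\<open>\<theta>\<close>,
  whose likelihood ratio \<open>\<Lambda>\<close> has second moment \<open>\<Prod>i. cosh (n \<theta>\<^sub>i\<^sup>2)\<close> under the null.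
  Integrating \<open>6 \<Lambda> \<le> \<Lambda>\<^sup>2 + 9\<close> over the rejection region forces this moment to be
  at least \<open>9 / 4\<close>.\<close>

lemma gof_ok_imp_sum_power4_ge:
  fixes \<theta> :: "real ^ 'd"
  assumes gof: "gof_ok \<Gamma> \<delta> n" and ortho: "orthosymmetric \<Gamma>"
    and \<theta>: "\<theta> \<in> \<Gamma>" "norm \<theta> \<ge> \<delta>"
  shows "1 \<le> (real n)\<^sup>2 * (\<Sum>i\<in>UNIV. (\<theta> $ i) ^ 4)"
proof -
  obtain \<psi> :: "(nat \<Rightarrow> real ^ 'd) \<Rightarrow> bool"
    where \<psi>[measurable]: "\<psi> \<in> measurable (sample_space n) (count_space UNIV)"
      and null: "measure (samples n 0) {x \<in> space (samples n 0). \<psi> x} \<le> 1/4"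
      and alt: "\<And>\<theta>. \<theta> \<in> \<Gamma> \<Longrightarrow> norm \<theta> \<ge> \<delta> \<Longrightarrow>
            measure (samples n \<theta>) {x \<in> space (samples n \<theta>). \<not> \<psi> x} \<le> 1/4"
    using gof unfolding gof_ok_def by blast
  interpret p: prob_space "samples n t" for t :: "real ^ 'd"
    by (rule prob_space_samples)
  define S where "S = (UNIV :: 'd set) \<rightarrow>\<^sub>E {-1, 1::real}"
  define sg where "sg s = (\<chi> i. s i * \<theta> $ i)" for s :: "'d \<Rightarrow> real"
  define E where "E = {x \<in> space (sample_space n). \<psi> x}"
  define L where "L s x = exp (sg s \<bullet> (\<Sum>j<n. x j) - real n * (norm (sg s))\<^sup>2 / 2)" for s x
  define N :: real where "N = 2 ^ CARD('d)"
  define Q where "Q = (\<Sum>i\<in>UNIV. (\<theta> $ i) ^ 4)"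
  have N: "N > 0" "real (card S) = N"
    unfolding N_def S_def by (auto simp: card_PiE)
  have finS: "finite S"
    unfolding S_def by (intro finite_PiE) auto
  have E[measurable]: "E \<in> sets (sample_space n)"
    unfolding E_def by measurable
  have L[measurable]: "L s \<in> borel_measurable (sample_space n)" for s
    unfolding L_def by measurable
  have Lpos: "L s x > 0" for s x
    by (simp add: L_def)
  have S_sg: "sg s \<in> \<Gamma>" "norm (sg s) = norm \<theta>" if "s \<in> S" for s
  proof -
    have *: "s i \<in> {-1, 1}" for i using that unfolding S_def by auto
    then show "sg s \<in> \<Gamma>" using ortho \<theta>(1) unfolding orthosymmetric_def sg_def by blast
    have "(s i)\<^sup>2 = 1" for i using *[of i] by auto
    then have "(norm (sg s))\<^sup>2 = (norm \<theta>)\<^sup>2"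
      by (simp add: norm_power2_vec sg_def power_mult_distrib)
    then show "norm (sg s) = norm \<theta>" by simp
  qed
  have P0: "emeasure (samples n 0) E \<le> ennreal (1/4)"
    using null by (simp add: p.emeasure_eq_measure E_def space_samples)
  \<comment> \<open>Every sign change of \<open>\<theta>\<close> is again an admissible alternative,
    so the test rejects there with probability at least 3/4.\<close>
  have PL: "ennreal (3/4) \<le> (\<integral>\<^sup>+x. ennreal (L s x * indicator E x) \<partial>samples n 0)" if "s \<in> S" for s
  proof -
    have "{x \<in> space (samples n (sg s)). \<not> \<psi> x} = space (samples n (sg s)) - E"
      by (auto simp: E_def space_samples)
    then have "3/4 \<le> measure (samples n (sg s)) E"
      using alt[of "sg s"] S_sg[OF that] \<theta>(2) p.prob_compl[of E "sg s"] by simp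
    then have "ennreal (3/4) \<le> emeasure (samples n (sg s)) E"
      by (simp add: p.emeasure_eq_measure)
    also have "\<dots> = (\<integral>\<^sup>+x. ennreal (L s x * indicator E x) \<partial>samples n 0)"
      by (subst samples_eq_density, subst emeasure_density)
         (auto simp: L_def ennreal_mult' ennreal_indicator intro!: nn_integral_cong)
    finally show ?thesis .
  qed
  \<comment> \<open>With \<open>\<Lambda>\<close> the average of the \<open>L s\<close>, the whole
    chain is scaled by \<open>N\<^sup>2\<close> to avoid division. The error bounds 3/4 and 1/4
    leave 6 * 3/4 - 9 * 1/4 = 9/4 for the second moment.\<close>
  have "ennreal (6 * N * (N * (3/4))) = (\<Sum>s\<in>S. ennreal (6 * N) * ennreal (3/4))"
    using N by (simp add: ennreal_mult[symmetric] ennreal_of_nat_eq_real_of_nat mult_ac)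
  also have "\<dots> \<le> (\<Sum>s\<in>S. ennreal (6 * N) * (\<integral>\<^sup>+x. ennreal (L s x * indicator E x) \<partial>samples n 0))"
    by (intro sum_mono mult_left_mono PL) auto
  also have "\<dots> = (\<integral>\<^sup>+x. (\<Sum>s\<in>S. ennreal (6 * N) * ennreal (L s x * indicator E x)) \<partial>samples n 0)"
    by (subst nn_integral_sum) (auto simp: nn_integral_cmult)
  also have "\<dots> \<le> (\<integral>\<^sup>+x. (\<Sum>s\<in>S. \<Sum>t\<in>S. ennreal (L s x * L t x))
      + ennreal (9 * N\<^sup>2) * indicator E x \<partial>samples n 0)"
  proof (intro nn_integral_mono)
    fix x
    let ?A = "\<Sum>s\<in>S. L s x"
    have "0 \<le> (?A - 3 * N)\<^sup>2" by simp
    then have "6 * N * ?A \<le> ?A * ?A + 9 * N\<^sup>2"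
      by (simp add: power2_eq_square algebra_simps)
    then have "6 * N * ?A * indicator E x \<le> ?A * ?A + 9 * N\<^sup>2 * indicator E x"
      by (auto simp: indicator_def)
    then have "ennreal (6 * N * ?A * indicator E x) \<le> ennreal (?A * ?A + 9 * N\<^sup>2 * indicator E x)"
      by (rule ennreal_leI)
    moreover have "(\<Sum>s\<in>S. ennreal (6 * N) * ennreal (L s x * indicator E x))
        = ennreal (6 * N * ?A * indicator E x)"
      using N Lpos by (simp add: ennreal_mult[symmetric] sum_ennreal less_imp_le
            sum_distrib_left sum_distrib_right mult_ac)
    moreover have "(\<Sum>s\<in>S. \<Sum>t\<in>S. ennreal (L s x * L t x)) + ennreal (9 * N\<^sup>2) * indicator E x
        = ennreal (?A * ?A + 9 * N\<^sup>2 * indicator E x)"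
      using Lpos by (cases "x \<in> E") (simp_all add: sum_ennreal less_imp_le sum_nonneg sum_product)
    ultimately show "(\<Sum>s\<in>S. ennreal (6 * N) * ennreal (L s x * indicator E x))
       \<le> (\<Sum>s\<in>S. \<Sum>t\<in>S. ennreal (L s x * L t x)) + ennreal (9 * N\<^sup>2) * indicator E x"
      by simp
  qed
  also have "\<dots> = (\<Sum>s\<in>S. \<Sum>t\<in>S. \<integral>\<^sup>+x. ennreal (L s x * L t x) \<partial>samples n 0)
      + ennreal (9 * N\<^sup>2) * emeasure (samples n 0) E"
    by (simp add: nn_integral_add nn_integral_sum nn_integral_cmult)
  also have "\<dots> = (\<Sum>s\<in>S. \<Sum>t\<in>S. ennreal (exp (real n * (sg s \<bullet> sg t))))
      + ennreal (9 * N\<^sup>2) * emeasure (samples n 0) E"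
    unfolding L_def nn_integral_likelihood_ratio_mult ..
  also have "\<dots> \<le> (\<Sum>s\<in>S. \<Sum>t\<in>S. ennreal (exp (real n * (sg s \<bullet> sg t))))
      + ennreal (9 * N\<^sup>2) * ennreal (1/4)"
    by (intro add_left_mono mult_left_mono P0) auto
  also have "\<dots> = ennreal ((\<Sum>s\<in>S. \<Sum>t\<in>S. exp (real n * (sg s \<bullet> sg t))) + 9 * N\<^sup>2 * (1/4))"
    by (simp add: sum_ennreal sum_nonneg ennreal_mult[symmetric])
  finally have "6 * N * (N * (3/4)) \<le> (\<Sum>s\<in>S. \<Sum>t\<in>S. exp (real n * (sg s \<bullet> sg t))) + 9 * N\<^sup>2 * (1/4)"
    by (subst (asm) ennreal_le_iff) (auto intro!: add_nonneg_nonneg sum_nonneg)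
  moreover have "(\<Sum>s\<in>S. \<Sum>t\<in>S. exp (real n * (sg s \<bullet> sg t))) \<le> (\<Sum>s\<in>S. N * exp ((real n)\<^sup>2 * Q / 2))"
    unfolding sg_def S_def N_def Q_def by (intro sum_mono sum_signs_exp_le)
  moreover have "(\<Sum>s\<in>S. N * exp ((real n)\<^sup>2 * Q / 2)) = N\<^sup>2 * exp ((real n)\<^sup>2 * Q / 2)"
    using N by (simp add: power2_eq_square)
  moreover have "6 * N * (N * (3/4)) = N\<^sup>2 * (9/2)"
    by (simp add: power2_eq_square)
  ultimately have "N\<^sup>2 * (9/4) \<le> N\<^sup>2 * exp ((real n)\<^sup>2 * Q / 2)"
    by linarith
  then have big: "9/4 \<le> exp ((real n)\<^sup>2 * Q / 2)"
    using N(1) by (simp add: mult_le_cancel_left)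
  show ?thesis
  proof (rule ccontr)
    \<comment> \<open>The exponent would then be at most 1/2, so \<open>exp 1\<close> would be at
      least 81/16, against \<open>exp 1 \<le> 3\<close>.\<close>
    assume "\<not> ?thesis"
    then have "exp ((real n)\<^sup>2 * Q / 2) \<le> exp (1/2)"
      by (simp add: Q_def)
    with big have "9/4 \<le> exp (1/2 :: real)" by linarith
    then have "(9/4)\<^sup>2 \<le> (exp (1/2 :: real))\<^sup>2"
      by (intro power_mono) auto
    also have "(exp (1/2 :: real))\<^sup>2 = exp 1"
      by (simp add: power2_eq_square flip: exp_add)
    finally show False
      using exp_le by (simp add: power2_eq_square)
  qed
qed

section \<open>Solidity of orthosymmetric convex sets and truncation\<close>

text \<open>Coordinates are replaced one at a time: averaging a point with its reflection in
  coordinate \<open>k\<close> shrinks that coordinate to any smaller absolute value and leaves the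
  others alone.\<close>

lemma orthosymmetric_convex_solid:
  fixes \<theta> u :: "real ^ 'd"
  assumes ortho: "orthosymmetric \<Gamma>" and conv: "convex \<Gamma>" and \<theta>: "\<theta> \<in> \<Gamma>"
    and u: "\<And>i. \<bar>u $ i\<bar> \<le> \<bar>\<theta> $ i\<bar>"
  shows "u \<in> \<Gamma>"
proof -
  have step: "(\<chi> i. if i \<in> S then u $ i else \<theta> $ i) \<in> \<Gamma>" if "finite S" for S :: "'d set"
    using that
  proof (induction S)
    case empty
    then show ?case using \<theta> by (simp add: vec_lambda_eta)
  next
    case (insert k S)
    let ?v = "\<chi> i. if i \<in> S then u $ i else \<theta> $ i"
    let ?w = "\<chi> i. (if i = k then -1 else 1) * ?v $ i"
    have w: "?w \<in> \<Gamma>"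
      using ortho insert.IH unfolding orthosymmetric_def by auto
    \<comment> \<open>The weights (1 + c)/2 and (1 - c)/2 scale coordinate \<open>k\<close> by
      \<open>c\<close>. If \<open>\<theta> $ k\<close> is 0, then so is \<open>u $ k\<close>, and
      any \<open>c\<close> in [-1, 1] would do.\<close>
    define c where "c = (if \<theta> $ k = 0 then 0 else u $ k / \<theta> $ k)"
    have c: "\<bar>c\<bar> \<le> 1" "c * \<theta> $ k = u $ k"
      using u[of k] by (auto simp: c_def)
    have "((1 + c) / 2) *\<^sub>R ?v + ((1 - c) / 2) *\<^sub>R ?w \<in> \<Gamma>"
      using c(1) by (intro convexD[OF conv insert.IH w]) (auto simp: field_simps)
    also have "((1 + c) / 2) *\<^sub>R ?v + ((1 - c) / 2) *\<^sub>R ?w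
        = (\<chi> i. if i \<in> insert k S then u $ i else \<theta> $ i)"
      using insert.hyps c(2) by (auto simp: vec_eq_iff field_simps)
    finally show ?case .
  qed
  from step[of UNIV] show ?thesis by (simp add: vec_lambda_eta)
qed

text \<open>Shrinking \<open>v\<close> to norm exactly \<open>\<delta>\<close> stays in the solid
  set and makes all coordinates at most \<open>T\<close>, so the fourth powers sum to at most
  \<open>T\<^sup>2 * \<delta>\<^sup>2\<close>. The scale-free hypothesis covers truncated vectors
  and also, with \<open>T = \<delta>\<close>, arbitrary ones.\<close>

lemma gof_ok_imp_bounded_ge:
  fixes v :: "real ^ 'd"
  assumes "gof_ok \<Gamma> \<delta> n" "orthosymmetric \<Gamma>" "convex \<Gamma>" "\<delta> > 0"
    and v: "v \<in> \<Gamma>" "norm v \<ge> \<delta>" "\<And>i. \<delta> * \<bar>v $ i\<bar> \<le> T * norm v"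
  shows "1 \<le> (real n)\<^sup>2 * T\<^sup>2 * \<delta>\<^sup>2"
proof -
  define w where "w = (\<delta> / norm v) *\<^sub>R v"
  have nv: "norm v > 0" using v(2) assms(4) by linarith
  have "\<bar>w $ i\<bar> \<le> \<bar>v $ i\<bar>" for i
    using v(2) assms(4) nv by (simp add: w_def abs_mult field_simps mult_right_mono)
  then have w: "w \<in> \<Gamma>"
    using orthosymmetric_convex_solid[OF assms(2,3) v(1)] by blast
  have nw: "norm w = \<delta>"
    using nv assms(4) by (simp add: w_def)
  have wi: "\<bar>w $ i\<bar> \<le> T" for i
    using v(3)[of i] nv assms(4) by (simp add: w_def abs_mult field_simps)
  have "(\<Sum>i\<in>UNIV. (w $ i) ^ 4) \<le> (\<Sum>i\<in>UNIV. T\<^sup>2 * (w $ i)\<^sup>2)"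
  proof (intro sum_mono)
    fix i
    have "(w $ i)\<^sup>2 \<le> T\<^sup>2"
      using power_mono[OF wi[of i], of 2] by simp
    then have "(w $ i)\<^sup>2 * (w $ i)\<^sup>2 \<le> T\<^sup>2 * (w $ i)\<^sup>2"
      by (intro mult_right_mono) auto
    then show "(w $ i) ^ 4 \<le> T\<^sup>2 * (w $ i)\<^sup>2"
      by (simp flip: power_add)
  qed
  also have "\<dots> = T\<^sup>2 * \<delta>\<^sup>2"
    by (simp add: sum_distrib_left[symmetric] norm_power2_vec[symmetric] nw)
  finally have "(real n)\<^sup>2 * (\<Sum>i\<in>UNIV. (w $ i) ^ 4) \<le> (real n)\<^sup>2 * (T\<^sup>2 * \<delta>\<^sup>2)"
    by (intro mult_left_mono) auto
  moreover have "1 \<le> (real n)\<^sup>2 * (\<Sum>i\<in>UNIV. (w $ i) ^ 4)"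
    using assms(1,2) w by (rule gof_ok_imp_sum_power4_ge) (simp add: nw)
  ultimately show ?thesis by (simp add: mult.assoc)
qed

lemma gof_ok_imp_sum_min_less:
  fixes \<theta> :: "real ^ 'd"
  assumes "gof_ok \<Gamma> \<delta> n" "orthosymmetric \<Gamma>" "convex \<Gamma>" "\<delta> > 0" "\<theta> \<in> \<Gamma>"
    and T: "T \<ge> 0" "(real n)\<^sup>2 * T\<^sup>2 * \<delta>\<^sup>2 < 1"
  shows "(\<Sum>i\<in>UNIV. min ((\<theta> $ i)\<^sup>2) (T\<^sup>2)) < \<delta>\<^sup>2"
proof -
  \<comment> \<open>The squared norm of this truncation is the sum to be bounded, and solidity keeps
    it in \<open>\<Gamma>\<close>.\<close>
  define v where "v = (\<chi> i. min \<bar>\<theta> $ i\<bar> T)"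
  have "v \<in> \<Gamma>"
    using T(1) by (intro orthosymmetric_convex_solid[OF assms(2,3,5)]) (auto simp: v_def)
  have "\<bar>v $ i\<bar> \<le> T" for i
    using T(1) by (auto simp: v_def)
  have "norm v < \<delta>"
  proof (rule ccontr)
    assume "\<not> norm v < \<delta>"
    then have "1 \<le> (real n)\<^sup>2 * T\<^sup>2 * \<delta>\<^sup>2"
      using \<open>v \<in> \<Gamma>\<close> \<open>\<And>i. \<bar>v $ i\<bar> \<le> T\<close> assms(4) T(1)
      by (intro gof_ok_imp_bounded_ge[OF assms(1-4), of v])
         (auto simp: mult.commute[of T] intro!: mult_mono)
    then show False using T(2) by simp
  qed
  then have "(norm v)\<^sup>2 < \<delta>\<^sup>2"
    by (intro power_strict_mono) auto
  moreover have "min ((\<theta> $ i)\<^sup>2) (T\<^sup>2) = (v $ i)\<^sup>2" for i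
    using T(1) abs_le_square_iff[of "\<theta> $ i" T] by (auto simp: v_def min_def)
  ultimately show ?thesis
    by (simp add: norm_power2_vec)
qed

section \<open>Tails and mean squared error of the sample mean\<close>

text \<open>A Chernoff bound for a truncated second moment: the part \<open>a\<close> of the
  exponent \<open>s\<close> absorbs the square, and the remaining \<open>s - a\<close> yields the
  decay in \<open>l\<close>.\<close>

lemma truncated_square_le_exp:
  fixes w a s l :: real
  assumes "0 < a" "a \<le> s" "l \<ge> 0"
  shows "(if \<bar>w\<bar> > l then w\<^sup>2 else 0)
     \<le> 2 / a\<^sup>2 * exp (- ((s - a) * l)) * (exp (s * w) + exp (- (s * w)))"
proof (cases "\<bar>w\<bar> > l")
  case True
  have "(a * \<bar>w\<bar>)\<^sup>2 / 2 \<le> exp (a * \<bar>w\<bar>)"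
    using exp_lower_Taylor_quadratic[of "a * \<bar>w\<bar>"] assms by (smt (verit) mult_nonneg_nonneg)
  then have "w\<^sup>2 \<le> 2 / a\<^sup>2 * exp (a * \<bar>w\<bar>)"
    using assms by (simp add: field_simps power_mult_distrib)
  also have "(s - a) * l \<le> (s - a) * \<bar>w\<bar>"
    using True assms by (intro mult_left_mono) auto
  then have "exp (a * \<bar>w\<bar>) \<le> exp (- ((s - a) * l) + s * \<bar>w\<bar>)"
    by (simp add: algebra_simps)
  then have "2 / a\<^sup>2 * exp (a * \<bar>w\<bar>) \<le> 2 / a\<^sup>2 * exp (- ((s - a) * l) + s * \<bar>w\<bar>)"
    by (intro mult_left_mono) auto
  also have "\<dots> = 2 / a\<^sup>2 * exp (- ((s - a) * l)) * exp (s * \<bar>w\<bar>)"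
    by (simp only: exp_add mult.assoc)
  also have "exp (s * \<bar>w\<bar>) \<le> exp (s * w) + exp (- (s * w))"
    by (cases "w \<ge> 0") auto
  then have "2 / a\<^sup>2 * exp (- ((s - a) * l)) * exp (s * \<bar>w\<bar>)
     \<le> 2 / a\<^sup>2 * exp (- ((s - a) * l)) * (exp (s * w) + exp (- (s * w)))"
    by (intro mult_left_mono) auto
  finally show ?thesis using True by simp
qed (use assms in \<open>auto intro!: add_nonneg_nonneg\<close>)

lemma nn_integral_sample_mean_tail_le:
  fixes \<theta> :: "real ^ 'd" and a s l :: real
  assumes m: "m > 0" and "0 < a" "a \<le> s" "l \<ge> 0"
  shows "(\<integral>\<^sup>+x. ennreal (let y = (\<Sum>j<m. x j) $ i / real m - \<theta> $ i
             in if \<bar>y\<bar> > l / sqrt (real m) then y\<^sup>2 else 0) \<partial>samples m \<theta>)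
     \<le> ennreal (4 / (a\<^sup>2 * real m) * exp (s\<^sup>2 / 2 - (s - a) * l))"
proof -
  let ?c = "2 / (a\<^sup>2 * real m) * exp (- ((s - a) * l))"
  \<comment> \<open>Scaled so that pairing with \<open>?X x\<close> gives \<open>s\<close> times the
    standardised error \<open>w\<close>, whose exponential moment is
    \<open>exp (s\<^sup>2 / 2)\<close>.\<close>
  let ?u = "axis i (s / sqrt (real m)) :: real ^ 'd"
  let ?X = "\<lambda>x :: nat \<Rightarrow> real ^ 'd. (\<Sum>j<m. x j) - real m *\<^sub>R \<theta>"
  have sm: "sqrt (real m) > 0" "sqrt (real m) * sqrt (real m) = real m" using m by auto
  have "(\<integral>\<^sup>+x. ennreal (let y = (\<Sum>j<m. x j) $ i / real m - \<theta> $ i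
             in if \<bar>y\<bar> > l / sqrt (real m) then y\<^sup>2 else 0) \<partial>samples m \<theta>)
     \<le> (\<integral>\<^sup>+x. ennreal ?c * (ennreal (exp (?u \<bullet> ?X x)) + ennreal (exp (- ?u \<bullet> ?X x))) \<partial>samples m \<theta>)"
  proof (intro nn_integral_mono)
    fix x :: "nat \<Rightarrow> real ^ 'd"
    define y where "y = (\<Sum>j<m. x j) $ i / real m - \<theta> $ i"
    define w where "w = sqrt (real m) * y"
    have X: "?X x $ i = real m * y"
      using m by (simp add: y_def field_simps)
    have ux: "?u \<bullet> ?X x = s * w"
    proof -
      have "?u \<bullet> ?X x = s / sqrt (real m) * (real m * y)"
        unfolding inner_commute[of ?u] inner_axis X by simp
      also have "\<dots> = s * w"
        using arg_cong[OF real_div_sqrt[of "real m"], of "\<lambda>r. s * (r * y)"] by (simp add: w_def)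
      finally show ?thesis .
    qed
    have "(if \<bar>w\<bar> > l then w\<^sup>2 else 0)
        \<le> 2 / a\<^sup>2 * exp (- ((s - a) * l)) * (exp (s * w) + exp (- (s * w)))"
      using assms by (intro truncated_square_le_exp) auto
    then have "(if \<bar>w\<bar> > l then w\<^sup>2 else 0) / real m
        \<le> 2 / a\<^sup>2 * exp (- ((s - a) * l)) * (exp (s * w) + exp (- (s * w))) / real m"
      by (intro divide_right_mono) auto
    also have "\<dots> = ?c * (exp (s * w) + exp (- (s * w)))"
      by simp
    also have "(if \<bar>w\<bar> > l then w\<^sup>2 else 0) / real m = (if \<bar>y\<bar> > l / sqrt (real m) then y\<^sup>2 else 0)"
      using sm m by (simp add: w_def abs_mult field_simps power_mult_distrib)
    finally show "ennreal (let y = (\<Sum>j<m. x j) $ i / real m - \<theta> $ i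
             in if \<bar>y\<bar> > l / sqrt (real m) then y\<^sup>2 else 0)
        \<le> ennreal ?c * (ennreal (exp (?u \<bullet> ?X x)) + ennreal (exp (- ?u \<bullet> ?X x)))"
      unfolding inner_minus_left ux Let_def y_def[symmetric]
      by (simp add: ennreal_mult[symmetric] ennreal_plus[symmetric] ennreal_leI del: ennreal_plus)
  qed
  also have "\<dots> = ennreal ?c * (ennreal (exp (real m * (norm ?u)\<^sup>2 / 2)) + ennreal (exp (real m * (norm (- ?u))\<^sup>2 / 2)))"
    by (subst nn_integral_cmult, measurable, subst nn_integral_add, measurable)
       (simp only: nn_integral_samples_exp)
  also have "real m * (norm ?u)\<^sup>2 / 2 = s\<^sup>2 / 2"
    using m by (simp add: power2_norm_eq_inner inner_axis_axis del: dot_square_norm) (simp add: power2_eq_square)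
  also have "real m * (norm (- ?u))\<^sup>2 / 2 = s\<^sup>2 / 2"
    using m by (simp add: power2_norm_eq_inner inner_axis_axis del: dot_square_norm) (simp add: power2_eq_square)
  also have "ennreal ?c * (ennreal (exp (s\<^sup>2 / 2)) + ennreal (exp (s\<^sup>2 / 2)))
      = ennreal (?c * (2 * exp (s\<^sup>2 / 2)))"
    by (simp add: ennreal_mult[symmetric] ennreal_plus[symmetric] del: ennreal_plus)
  also have "?c * (2 * exp (s\<^sup>2 / 2)) = 4 / (a\<^sup>2 * real m) * exp (s\<^sup>2 / 2 - (s - a) * l)"
    unfolding diff_conv_add_uminus[of "s\<^sup>2 / 2"] exp_add by simp
  finally show ?thesis .
qed

lemma nn_integral_sample_mean_error_le:
  fixes \<theta> :: "real ^ 'd"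
  assumes m: "m > 0"
  shows "(\<integral>\<^sup>+x. ennreal ((norm ((1 / real m) *\<^sub>R (\<Sum>j<m. x j) - \<theta>))\<^sup>2) \<partial>samples m \<theta>)
     \<le> ennreal (8 * real CARD('d) / real m)"
proof -
  have "exp (1/2 :: real) \<le> 2"
  proof (rule power2_le_imp_le)
    have "(exp (1/2 :: real))\<^sup>2 = exp 1"
      by (simp add: power2_eq_square flip: exp_add)
    then show "(exp (1/2 :: real))\<^sup>2 \<le> 2\<^sup>2" using exp_le by simp
  qed simp
  have "(\<integral>\<^sup>+x. ennreal ((norm ((1 / real m) *\<^sub>R (\<Sum>j<m. x j) - \<theta>))\<^sup>2) \<partial>samples m \<theta>)
     = (\<integral>\<^sup>+x. (\<Sum>i\<in>UNIV. ennreal (((\<Sum>j<m. x j) $ i / real m - \<theta> $ i)\<^sup>2)) \<partial>samples m \<theta>)"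
    by (intro nn_integral_cong) (simp add: norm_power2_vec sum_ennreal)
  also have "\<dots> = (\<Sum>i\<in>UNIV. \<integral>\<^sup>+x. ennreal (((\<Sum>j<m. x j) $ i / real m - \<theta> $ i)\<^sup>2) \<partial>samples m \<theta>)"
    by (rule nn_integral_sum) measurable
  also have "\<dots> \<le> (\<Sum>i\<in>(UNIV :: 'd set). ennreal (8 / real m))"
  proof (intro sum_mono)
    fix i
    have *: "((if 0 < \<bar>y\<bar> then y\<^sup>2 else 0) :: real) = y\<^sup>2" for y by auto
    \<comment> \<open>The tail bound with \<open>a = s = 1\<close> and \<open>l = 0\<close>
      truncates nothing; its constant 4 * exp (1/2) is rounded up to 8.\<close>
    have "(\<integral>\<^sup>+x. ennreal (((\<Sum>j<m. x j) $ i / real m - \<theta> $ i)\<^sup>2) \<partial>samples m \<theta>)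
        \<le> ennreal (4 / (1\<^sup>2 * real m) * exp (1\<^sup>2 / 2 - (1 - 1) * 0))"
      using nn_integral_sample_mean_tail_le[OF m zero_less_one order_refl order_refl, of \<theta> i]
      unfolding Let_def div_0 * .
    also have "\<dots> \<le> ennreal (8 / real m)"
      using m \<open>exp (1/2 :: real) \<le> 2\<close> by (intro ennreal_leI) (simp add: divide_simps)
    finally show "(\<integral>\<^sup>+x. ennreal (((\<Sum>j<m. x j) $ i / real m - \<theta> $ i)\<^sup>2) \<partial>samples m \<theta>)
        \<le> ennreal (8 / real m)" .
  qed
  also have "\<dots> = ennreal (8 * real CARD('d) / real m)"
    using m by (simp add: ennreal_of_nat_eq_real_of_nat ennreal_mult[symmetric] mult.commute)
  finally show ?thesis .
qed

section \<open>Chebyshev's bound and the existence of a test\<close>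

text \<open>Markov's inequality for the squared error: 4 / \<open>\<delta>\<^sup>2\<close> times 8 D
  / n is at most 1/4 exactly when \<open>\<delta>\<^sup>2\<close> n is at least 128 D, where D is
  the dimension.\<close>

lemma sample_mean_deviation_le:
  fixes \<theta> :: "real ^ 'd"
  assumes "\<delta> > 0" "n > 0" "128 * real CARD('d) \<le> \<delta>\<^sup>2 * real n"
  shows "measure (samples n \<theta>) {x \<in> space (samples n \<theta>).
     \<delta> / 2 \<le> norm ((1 / real n) *\<^sub>R (\<Sum>j<n. x j) - \<theta>)} \<le> 1/4"
proof -
  interpret p: prob_space "samples n \<theta>" by (rule prob_space_samples)
  let ?e = "\<lambda>x :: nat \<Rightarrow> real ^ 'd. norm ((1 / real n) *\<^sub>R (\<Sum>j<n. x j) - \<theta>)"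
  let ?A = "{x \<in> space (samples n \<theta>). \<delta> / 2 \<le> ?e x}"
  let ?B = "{x \<in> space (samples n \<theta>). 1 \<le> ennreal (4 / \<delta>\<^sup>2) * ennreal ((?e x)\<^sup>2)}"
  have "?A \<subseteq> ?B"
  proof
    fix x assume x: "x \<in> ?A"
    then have "(\<delta> / 2)\<^sup>2 \<le> (?e x)\<^sup>2"
      using assms(1) by (intro power_mono) auto
    then have "1 \<le> (4 / \<delta>\<^sup>2) * (?e x)\<^sup>2"
      using assms(1) by (simp add: power_divide field_simps)
    then have "ennreal 1 \<le> ennreal ((4 / \<delta>\<^sup>2) * (?e x)\<^sup>2)"
      by (rule ennreal_leI)
    also have "\<dots> = ennreal (4 / \<delta>\<^sup>2) * ennreal ((?e x)\<^sup>2)"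
      by (rule ennreal_mult) auto
    finally show "x \<in> ?B"
      using x by simp
  qed
  then have "emeasure (samples n \<theta>) ?A \<le> emeasure (samples n \<theta>) ?B"
    by (intro emeasure_mono) measurable
  also have "\<dots> \<le> ennreal (4 / \<delta>\<^sup>2) * (\<integral>\<^sup>+x. ennreal ((?e x)\<^sup>2) * indicator (space (samples n \<theta>)) x \<partial>samples n \<theta>)"
    by (rule nn_integral_Markov_inequality) measurable
  also have "\<dots> = ennreal (4 / \<delta>\<^sup>2) * (\<integral>\<^sup>+x. ennreal ((?e x)\<^sup>2) \<partial>samples n \<theta>)"
    by (intro arg_cong2[where f = "(*)"] nn_integral_cong) auto
  also have "\<dots> \<le> ennreal (4 / \<delta>\<^sup>2) * ennreal (8 * real CARD('d) / real n)"
    using assms by (intro mult_left_mono nn_integral_sample_mean_error_le) auto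
  also have "\<dots> = ennreal (4 / \<delta>\<^sup>2 * (8 * real CARD('d) / real n))"
    by (rule ennreal_mult[symmetric]) auto
  also have "\<dots> \<le> ennreal (1 / 4)"
    using assms by (intro ennreal_leI) (simp add: field_simps)
  finally show ?thesis
    by (simp add: p.emeasure_eq_measure)
qed

text \<open>Ensures that the \<open>LEAST\<close> in \<open>n_gof\<close> is attained. The test
  rejects when the sample mean has norm at least \<open>\<delta> / 2\<close>; by the triangle
  inequality both kinds of error force a deviation of at least \<open>\<delta> / 2\<close>.\<close>

lemma gof_ok_exists:
  fixes \<Gamma> :: "(real ^ 'd) set"
  assumes \<delta>: "\<delta> > 0"
  shows "\<exists>n. gof_ok \<Gamma> \<delta> n"
proof -
  obtain n0 :: nat where "128 * real CARD('d) / \<delta>\<^sup>2 \<le> real n0"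
    using real_arch_simple by blast
  then have n: "128 * real CARD('d) \<le> \<delta>\<^sup>2 * real (Suc n0)"
    using \<delta> by (simp add: field_simps) (smt (verit) zero_le_power2)
  define n where "n = Suc n0"
  let ?\<mu> = "\<lambda>x :: nat \<Rightarrow> real ^ 'd. (1 / real n) *\<^sub>R (\<Sum>j<n. x j)"
  have dev: "measure (samples n \<theta>) {x \<in> space (samples n \<theta>). \<delta> / 2 \<le> norm (?\<mu> x - \<theta>)} \<le> 1/4"
    for \<theta> :: "real ^ 'd"
    using n by (intro sample_mean_deviation_le[OF \<delta>]) (auto simp: n_def)
  have "gof_ok \<Gamma> \<delta> n"
    unfolding gof_ok_def
  proof (intro exI[of _ "\<lambda>x. \<delta> / 2 \<le> norm (?\<mu> x)"] conjI ballI impI)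
    show "(\<lambda>x. \<delta> / 2 \<le> norm (?\<mu> x)) \<in> measurable (sample_space n) (count_space UNIV)"
      by measurable
    show "measure (samples n 0) {x \<in> space (samples n 0). \<delta> / 2 \<le> norm (?\<mu> x)} \<le> 1/4"
      using dev[of 0] by simp
    fix \<theta> :: "real ^ 'd" assume \<theta>: "\<delta> \<le> norm \<theta>"
    interpret p: prob_space "samples n \<theta>" by (rule prob_space_samples)
    have "measure (samples n \<theta>) {x \<in> space (samples n \<theta>). \<not> \<delta> / 2 \<le> norm (?\<mu> x)}
        \<le> measure (samples n \<theta>) {x \<in> space (samples n \<theta>). \<delta> / 2 \<le> norm (?\<mu> x - \<theta>)}"
    proof (intro p.finite_measure_mono subsetI)
      fix x assume "x \<in> {x \<in> space (samples n \<theta>). \<not> \<delta> / 2 \<le> norm (?\<mu> x)}"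
      then show "x \<in> {x \<in> space (samples n \<theta>). \<delta> / 2 \<le> norm (?\<mu> x - \<theta>)}"
        using \<theta> norm_triangle_ineq2[of \<theta> "?\<mu> x"] by (auto simp: norm_minus_commute)
    qed measurable
    also have "\<dots> \<le> 1/4" by (rule dev)
    finally show "measure (samples n \<theta>) {x \<in> space (samples n \<theta>). \<not> \<delta> / 2 \<le> norm (?\<mu> x)} \<le> 1/4" .
  qed
  then show ?thesis ..
qed

section \<open>Soft thresholding and its risk\<close>

text \<open>For nonnegative \<open>\<tau>\<close> this is the usual sign(y) max(|y| -
  \<open>\<tau>\<close>, 0), written as \<open>y\<close> minus its projection onto the interval from
  \<open>- \<tau>\<close> to \<open>\<tau>\<close>, so continuity is immediate.\<close>

definition soft_threshold :: "real \<Rightarrow> real \<Rightarrow> real" where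
  "soft_threshold \<tau> y = y - max (- \<tau>) (min \<tau> y)"

text \<open>If the noise \<open>y - t\<close> is at most \<open>\<tau>\<close> in size, the output
  lies between 0 and \<open>t\<close>, and its error is at most noise plus \<open>\<tau>\<close>.
  Larger noise at most doubles, hence the factor 4.\<close>

lemma soft_threshold_error_le:
  assumes "\<tau> \<ge> 0"
  shows "(soft_threshold \<tau> y - t)\<^sup>2
     \<le> min (t\<^sup>2) ((2 * \<tau>)\<^sup>2) + 4 * (if \<bar>y - t\<bar> > \<tau> then (y - t)\<^sup>2 else 0)"
proof (cases "\<bar>y - t\<bar> > \<tau>")
  case True
  then have "\<bar>soft_threshold \<tau> y - t\<bar> \<le> 2 * \<bar>y - t\<bar>"
  proof -
    define c where "c = max (- \<tau>) (min \<tau> y)"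
    have "\<bar>c\<bar> \<le> \<tau>" using assms by (auto simp: c_def)
    then show ?thesis using True abs_triangle_ineq4[of "y - t" c]
      unfolding soft_threshold_def c_def[symmetric] by (simp add: algebra_simps)
  qed
  then have "(soft_threshold \<tau> y - t)\<^sup>2 \<le> (2 * (y - t))\<^sup>2"
    unfolding abs_le_square_iff[symmetric] abs_mult by simp
  also have "\<dots> = 4 * (y - t)\<^sup>2"
    unfolding power_mult_distrib by simp
  finally show ?thesis using True by (auto intro: add_increasing)
next
  case False
  then have "\<bar>soft_threshold \<tau> y - t\<bar> \<le> \<bar>t\<bar>" "\<bar>soft_threshold \<tau> y - t\<bar> \<le> \<bar>2 * \<tau>\<bar>"
    using assms by (auto simp: soft_threshold_def)
  then show ?thesis
    unfolding abs_le_square_iff using False by simp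
qed

lemma soft_threshold_risk:
  fixes m :: nat
  defines "L \<equiv> ln (2 * real CARD('d))"
  assumes m: "m > 0"
  obtains f :: "(nat \<Rightarrow> real ^ 'd) \<Rightarrow> real ^ 'd"
  where "f \<in> borel_measurable (sample_space m)"
    and "\<And>\<theta>. (\<integral>\<^sup>+x. ennreal ((norm (f x - \<theta>))\<^sup>2) \<partial>samples m \<theta>)
       \<le> ennreal ((\<Sum>i\<in>UNIV. min ((\<theta> $ i)\<^sup>2) (64 * L / real m)) + 8 / real m)"
proof -
  define D where "D = real CARD('d)"
  have D: "D \<ge> 1" by (simp add: D_def)
  have "ln 2 \<le> L"
    using D by (simp add: L_def D_def[symmetric])
  then have L: "L \<ge> 1/2"
    using ln2_ge_two_thirds by linarith
  have expL: "exp L = 2 * D"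
    using D by (simp add: L_def D_def[symmetric])
  \<comment> \<open>Large enough that the noise terms of all coordinates together cost only 8 / m,
    with no logarithm left.\<close>
  define \<tau> where "\<tau> = 4 * sqrt L / sqrt (real m)"
  have \<tau>: "\<tau> \<ge> 0" "(2 * \<tau>)\<^sup>2 = 64 * L / real m"
    using L by (auto simp: \<tau>_def power_divide power_mult_distrib)
  define f :: "(nat \<Rightarrow> real ^ 'd) \<Rightarrow> real ^ 'd"
    where "f x = (\<chi> i. soft_threshold \<tau> ((\<Sum>j<m. x j) $ i / real m))" for x
  have "continuous_on UNIV (\<lambda>v :: real ^ 'd. \<chi> i. soft_threshold \<tau> (v $ i / real m))"
    unfolding soft_threshold_def using m by (intro continuous_intros) auto
  then have [measurable]: "(\<lambda>v :: real ^ 'd. \<chi> i. soft_threshold \<tau> (v $ i / real m)) \<in> borel_measurable borel"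
    by (rule borel_measurable_continuous_onI)
  have "f \<in> borel_measurable (sample_space m)"
    unfolding f_def by (rule measurable_compose[OF measurable_sum_samples]) measurable
  moreover have "(\<integral>\<^sup>+x. ennreal ((norm (f x - \<theta>))\<^sup>2) \<partial>samples m \<theta>)
       \<le> ennreal ((\<Sum>i\<in>UNIV. min ((\<theta> $ i)\<^sup>2) (64 * L / real m)) + 8 / real m)" for \<theta>
  proof -
    interpret p: prob_space "samples m \<theta>" by (rule prob_space_samples)
    let ?y = "\<lambda>x i. (\<Sum>j<m. x j) $ i / real m"
    let ?t = "\<lambda>x i. let y = ?y x i - \<theta> $ i in if \<bar>y\<bar> > \<tau> then y\<^sup>2 else 0"
    let ?b = "\<lambda>i. min ((\<theta> $ i)\<^sup>2) (64 * L / real m)"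
    have b: "?b i \<ge> 0" for i using L by simp
    have [measurable]: "(\<lambda>x. ?t x i) \<in> borel_measurable (sample_space m)" for i
      unfolding Let_def by measurable
    have "(\<integral>\<^sup>+x. ennreal ((norm (f x - \<theta>))\<^sup>2) \<partial>samples m \<theta>)
      \<le> (\<integral>\<^sup>+x. (\<Sum>i\<in>UNIV. ennreal (?b i) + ennreal 4 * ennreal (?t x i)) \<partial>samples m \<theta>)"
    proof (intro nn_integral_mono)
      fix x :: "nat \<Rightarrow> real ^ 'd"
      have "(norm (f x - \<theta>))\<^sup>2 \<le> (\<Sum>i\<in>UNIV. ?b i + 4 * ?t x i)"
        unfolding norm_power2_vec
        using soft_threshold_error_le[OF \<tau>(1), unfolded \<tau>(2)]
        by (intro sum_mono) (simp only: f_def Let_def vector_minus_component vec_lambda_beta)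
      then have "ennreal ((norm (f x - \<theta>))\<^sup>2) \<le> ennreal (\<Sum>i\<in>UNIV. ?b i + 4 * ?t x i)"
        by (rule ennreal_leI)
      also have "\<dots> = (\<Sum>i\<in>UNIV. ennreal (?b i + 4 * ?t x i))"
        using b by (intro sum_ennreal[symmetric] add_nonneg_nonneg) (auto simp: Let_def)
      also have "\<dots> = (\<Sum>i\<in>UNIV. ennreal (?b i) + ennreal 4 * ennreal (?t x i))"
        using b by (intro sum.cong refl)
          (subst ennreal_plus, auto simp: Let_def ennreal_mult)
      finally show "ennreal ((norm (f x - \<theta>))\<^sup>2)
          \<le> (\<Sum>i\<in>UNIV. ennreal (?b i) + ennreal 4 * ennreal (?t x i))" .
    qed
    also have "\<dots> = (\<Sum>i\<in>UNIV. \<integral>\<^sup>+x. ennreal (?b i) + ennreal 4 * ennreal (?t x i) \<partial>samples m \<theta>)"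
      by (rule nn_integral_sum) measurable
    also have "\<dots> = (\<Sum>i\<in>UNIV. ennreal (?b i) + ennreal 4 * (\<integral>\<^sup>+x. ennreal (?t x i) \<partial>samples m \<theta>))"
      by (intro sum.cong refl, subst nn_integral_add, measurable, subst nn_integral_cmult, measurable)
         (simp add: p.emeasure_space_1)
    also have "\<dots> \<le> (\<Sum>i\<in>UNIV. ennreal (?b i) + ennreal 4 * ennreal (2 / (D * real m)))"
    proof (intro sum_mono add_left_mono mult_left_mono)
      fix i
      \<comment> \<open>The tail bound is used with \<open>s = 2 * sqrt L\<close>,
        \<open>a = sqrt L / 2\<close> and \<open>l = 4 * sqrt L\<close>; the exponent is 2 L - 6
        L.\<close>
      have "exp ((2 * sqrt L)\<^sup>2 / 2 - (2 * sqrt L - sqrt L / 2) * (4 * sqrt L)) = exp (- 4 * L)"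
        using L by (simp add: algebra_simps power2_eq_square)
      also have "\<dots> = inverse ((exp L) ^ 4)"
        by (simp add: exp_of_nat_mult[symmetric] exp_minus)
      also have "\<dots> = 1 / (16 * D ^ 4)"
        by (simp add: expL power_mult_distrib inverse_eq_divide)
      finally have ex: "exp ((2 * sqrt L)\<^sup>2 / 2 - (2 * sqrt L - sqrt L / 2) * (4 * sqrt L)) = 1 / (16 * D ^ 4)" .
      have "(\<integral>\<^sup>+x. ennreal (?t x i) \<partial>samples m \<theta>)
          \<le> ennreal (4 / ((sqrt L / 2)\<^sup>2 * real m) * (1 / (16 * D ^ 4)))"
        unfolding \<tau>_def ex[symmetric] using L
        by (intro nn_integral_sample_mean_tail_le[OF m]) auto
      also have "4 / ((sqrt L / 2)\<^sup>2 * real m) * (1 / (16 * D ^ 4)) = 1 / (L * D ^ 4 * real m)"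
        using L by (simp add: power_divide)
      also have "\<dots> \<le> 2 / (D * real m)"
      proof -
        have "D ^ 1 \<le> D ^ 4"
          using D by (intro power_increasing) auto
        then have "1/2 * D \<le> L * D ^ 4"
          using L D by (intro mult_mono) auto
        then show ?thesis
          using L D m by (simp add: field_simps)
      qed
      finally show "(\<integral>\<^sup>+x. ennreal (?t x i) \<partial>samples m \<theta>) \<le> ennreal (2 / (D * real m))"
        by (simp add: ennreal_leI)
    qed auto
    also have "\<dots> = (\<Sum>i\<in>UNIV. ennreal (?b i + 8 / (D * real m)))"
    proof (intro sum.cong refl)
      fix i
      have "ennreal 4 * ennreal (2 / (D * real m)) = ennreal (8 / (D * real m))"
        using D by (subst ennreal_mult[symmetric]) auto
      then show "ennreal (?b i) + ennreal 4 * ennreal (2 / (D * real m)) = ennreal (?b i + 8 / (D * real m))"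
        using b[of i] D by (simp only: ennreal_plus[symmetric]) simp
    qed
    also have "\<dots> = ennreal (\<Sum>i\<in>UNIV. ?b i + 8 / (D * real m))"
      using b D by (intro sum_ennreal add_nonneg_nonneg) auto
    also have "(\<Sum>i\<in>UNIV. ?b i + 8 / (D * real m)) = (\<Sum>i\<in>UNIV. ?b i) + 8 / real m"
      using D by (simp add: sum.distrib D_def)
    finally show ?thesis .
  qed
  ultimately show ?thesis by (rule that)
qed

section \<open>Choice of the sample size and conclusion\<close>

theorem mainTheorem3:
  fixes \<Gamma> :: "(real ^ 'd) set" and \<epsilon> :: real
  assumes "orthosymmetric \<Gamma>" and "compact \<Gamma>" and "convex \<Gamma>" and "\<epsilon> > 0"
  shows "(real (n_gof \<Gamma> (\<epsilon> / sqrt 2)))\<^sup>2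
           \<ge> 1 / (64 * ln (2 * real CARD('d))) * (real (n_est \<Gamma> \<epsilon>) / \<epsilon>\<^sup>2)"
proof (cases "\<exists>\<theta>\<in>\<Gamma>. norm \<theta> \<ge> \<epsilon> / sqrt 2")
  case False
  \<comment> \<open>All of \<open>\<Gamma>\<close> lies within \<open>\<epsilon>\<close> of the
    origin, so the zero estimator needs no samples and the left factor \<open>n_est\<close>
    vanishes.\<close>
  have "est_ok \<Gamma> \<epsilon> 0"
    unfolding est_ok_def
  proof (intro exI[of _ "\<lambda>_. 0"] conjI ballI)
    fix \<theta> assume "\<theta> \<in> \<Gamma>"
    interpret p: prob_space "samples 0 \<theta>" by (rule prob_space_samples)
    have "norm \<theta> \<le> \<epsilon> / sqrt 2"
      using False \<open>\<theta> \<in> \<Gamma>\<close> by force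
    also have "\<dots> \<le> \<epsilon>"
      using assms(4) by (simp add: divide_le_eq)
    finally have "(norm \<theta>)\<^sup>2 \<le> \<epsilon>\<^sup>2"
      by (intro power_mono) auto
    then show "(\<integral>\<^sup>+x. ennreal ((norm (0 - \<theta>))\<^sup>2) \<partial>samples 0 \<theta>) \<le> ennreal (\<epsilon>\<^sup>2)"
      by (simp add: p.emeasure_space_1 ennreal_leI)
  qed simp
  then have "n_est \<Gamma> \<epsilon> = 0"
    unfolding n_est_def by (rule Least_eq_0)
  then show ?thesis by simp
next
  case True
  then obtain \<theta>\<^sub>0 where \<theta>\<^sub>0: "\<theta>\<^sub>0 \<in> \<Gamma>" "norm \<theta>\<^sub>0 \<ge> \<epsilon> / sqrt 2" by blast
  define L where "L = ln (2 * real CARD('d))"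
  define \<delta> where "\<delta> = \<epsilon> / sqrt 2"
  define n where "n = n_gof \<Gamma> \<delta>"
  have \<delta>: "\<delta> > 0" "\<delta>\<^sup>2 = \<epsilon>\<^sup>2 / 2"
    using assms(4) by (auto simp: \<delta>_def power_divide)
  have gof: "gof_ok \<Gamma> \<delta> n"
    unfolding n_def n_gof_def using gof_ok_exists[OF \<delta>(1)] by (rule LeastI_ex)
  have "real CARD('d) \<ge> 1" by simp
  then have "ln 2 \<le> L"
    by (simp add: L_def)
  then have L: "L \<ge> 1/2"
    using ln2_ge_two_thirds by linarith
  \<comment> \<open>Taking \<open>T = \<delta>\<close> makes the coordinate condition automatic. The
    result excludes \<open>n = 0\<close> and later absorbs the remainder 8 / m.\<close>
  have "1 \<le> (real n)\<^sup>2 * \<delta>\<^sup>2 * \<delta>\<^sup>2"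
    using \<theta>\<^sub>0 \<delta> component_le_norm_cart[of \<theta>\<^sub>0]
    by (intro gof_ok_imp_bounded_ge[OF gof assms(1,3) \<delta>(1), of \<theta>\<^sub>0])
       (auto simp: \<delta>_def[symmetric] intro!: mult_left_mono)
  then have ne: "4 \<le> (real n)\<^sup>2 * \<epsilon>\<^sup>2 * \<epsilon>\<^sup>2"
    by (simp add: \<delta>(2))
  then have "n > 0" by (intro gr0I) simp
  define X where "X = (real n)\<^sup>2 * \<epsilon>\<^sup>2"
  have X: "X \<ge> 2"
  proof (rule power2_le_imp_le)
    have "1 * 4 \<le> (real n)\<^sup>2 * ((real n)\<^sup>2 * \<epsilon>\<^sup>2 * \<epsilon>\<^sup>2)"
      using \<open>n > 0\<close> ne by (intro mult_mono) auto
    then show "2\<^sup>2 \<le> X\<^sup>2"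
      by (simp add: X_def power2_eq_square mult_ac)
  qed (simp add: X_def)
  have LX: "1/2 * 2 \<le> L * X"
    using L X by (intro mult_mono) auto
  \<comment> \<open>Rounding down keeps \<open>m\<close> below the bound claimed for
    \<open>n_est\<close>; since \<open>L * X\<close> is at least 1, it loses at most
    \<open>L * X\<close>.\<close>
  define m where "m = nat \<lfloor>64 * L * X\<rfloor>"
  have m: "real m \<le> 64 * L * X" "63 * L * X \<le> real m"
    using LX unfolding m_def by linarith+
  have m0: "m > 0" using m(2) LX by (intro gr0I) simp
  \<comment> \<open>The truncation level is twice the threshold of the estimator, so the sum bounded
    by testing is the one in the risk. The choice of \<open>m\<close> makes the product in
    \<open>T1\<close> equal to 32 L X / m, about one half.\<close>
  define T where "T = sqrt (64 * L / real m)"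
  have T: "T \<ge> 0" "T\<^sup>2 = 64 * L / real m"
    using L by (auto simp: T_def)
  have T1: "(real n)\<^sup>2 * T\<^sup>2 * \<delta>\<^sup>2 < 1"
  proof -
    have "32 * L * X < real m"
      using m(2) LX by linarith
    then show ?thesis
      using m0 by (simp add: T(2) \<delta>(2) X_def field_simps)
  qed
  have tail: "8 / real m \<le> \<epsilon>\<^sup>2 / 2"
  proof -
    have "1/2 * 4 \<le> L * (X * \<epsilon>\<^sup>2)"
      using L ne by (intro mult_mono) (auto simp: X_def)
    then have "16 \<le> 63 * L * X * \<epsilon>\<^sup>2" by simp
    also have "\<dots> \<le> real m * \<epsilon>\<^sup>2"
      using m(2) by (intro mult_right_mono) auto
    finally show ?thesis
      using m0 by (simp add: field_simps)
  qed
  obtain f :: "(nat \<Rightarrow> real ^ 'd) \<Rightarrow> real ^ 'd" where f: "f \<in> borel_measurable (sample_space m)"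
    and risk: "\<And>\<theta>. (\<integral>\<^sup>+x. ennreal ((norm (f x - \<theta>))\<^sup>2) \<partial>samples m \<theta>)
       \<le> ennreal ((\<Sum>i\<in>UNIV. min ((\<theta> $ i)\<^sup>2) (64 * L / real m)) + 8 / real m)"
    using soft_threshold_risk[OF m0] unfolding L_def by metis
  have "est_ok \<Gamma> \<epsilon> m"
    unfolding est_ok_def
  proof (intro exI[of _ f] conjI ballI f)
    fix \<theta> assume "\<theta> \<in> \<Gamma>"
    then have "(\<Sum>i\<in>UNIV. min ((\<theta> $ i)\<^sup>2) (64 * L / real m)) < \<delta>\<^sup>2"
      using gof_ok_imp_sum_min_less[OF gof assms(1,3) \<delta>(1) _ T(1) T1] by (simp add: T(2))
    then show "(\<integral>\<^sup>+x. ennreal ((norm (f x - \<theta>))\<^sup>2) \<partial>samples m \<theta>) \<le> ennreal (\<epsilon>\<^sup>2)"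
      using tail \<delta>(2) by (intro order.trans[OF risk] ennreal_leI) linarith
  qed
  then have "n_est \<Gamma> \<epsilon> \<le> m"
    unfolding n_est_def by (rule Least_le)
  then have "real (n_est \<Gamma> \<epsilon>) \<le> 64 * L * ((real n)\<^sup>2 * \<epsilon>\<^sup>2)"
    using m(1) unfolding X_def by linarith
  then show ?thesis
    using assms(4) L unfolding n_def[unfolded \<delta>_def, symmetric] L_def[symmetric]
    by (simp add: field_simps)
qed

end
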